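(* Let $m\ge 1$ be an integer and let $(x_k)_{k\ge 0}$ be generated by Anderson acceleration AA($m$) from an initial guess $x_0\in\mathbb{R}^n$, applied to the linear fixed-point function $q(x)=Mx+b$, with residuals $r_k=x_k-q(x_k)$. Then $k$ steps of AA($m$) cannot produce a residual that is smaller in the 2-norm than the residual obtained by $k$ steps of (non-restarted) GMRES applied to the corresponding linear system $Ax=b$, $A=I-M$, with the same initial guess $x_0$; that is, for every $k$, $\|r_k\|\ge\|r_k^{G}\|$, where $r_k^G$ is the GMRES residual after $k$ steps.
   Context: Setting: $M\in\mathbb{R}^{n\times n}$, $b\in\mathbb{R}^n$, $q(x)=Mx+b$, $A=I-M$ is nonsingular and $M\neq 0$. $\|\cdot\|$ is the 2-norm. The residual is $r(x)=x-q(x)=Ax-b$ and $r_k=r(x_k)$. AA($m$) with finite window size $m$: given $x_0\in\mathbb{R}^n$, for $k=0,1,2,\ldots$, with $m_k=\min(k,m)$, $$x_{k+1}=q(x_k)+\sum_{i=1}^{m_k}\beta_i^{(k)}\big(q(x_k)-q(x_{k-i})\big)$$ (so $x_1=q(x_0)$). The coefficient vector $\boldsymbol\beta^{(k)}=(\beta_1^{(k)},\ldots,\beta_{m_k}^{(k)})^T$ is the minimum-norm minimizer of $\|r_k+\sum_{i=1}^{m_k}\beta_i(r_k-r_{k-i})\|^2$, i.e. $\boldsymbol\beta^{(k)}=-R_k^{\dagger}r_k$ with $R_k=[\,r_k-r_{k-1}\ \cdots\ r_k-r_{k-m_k}\,]$ and $\dagger$ the pseudo-inverse. GMRES after $k$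 steps from $x_0$ produces $x_k^G\in x_0+\mathcal{K}_k(A,r_0)$, $\mathcal{K}_k(A,r_0)=\mathrm{span}\{r_0,Ar_0,\ldots,A^{k-1}r_0\}$, minimizing $\|Ax-b\|$ over that affine space, and $r_k^G=Ax_k^G-b$; equivalently $\|r_k^G\|=\min\|p(M)r_0\|$ over polynomials $p$ of degree at most $k$ with $p(1)=1$. *)

theory Defs
  imports "HOL-Analysis.Analysis"
begin

definition fp_map :: "real^'n^'n \<Rightarrow> real^'n \<Rightarrow> real^'n \<Rightarrow> real^'n" where
  "fp_map M b x = M *v x + b"

definition fp_residual :: "real^'n^'n \<Rightarrow> real^'n \<Rightarrow> real^'n \<Rightarrow> real^'n" where
  "fp_residual M b x = x - fp_map M b x"

text \<open>A coefficient vector of length \<open>p\<close> is a function on the naturals of which only the values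
  on \<open>{1..p}\<close> matter.  The predicate selects, among all minimizers of the least-squares
  functional at step \<open>k\<close> with window \<open>p \<le> k\<close>, those of smallest 2-norm; on \<open>{1..p}\<close> this is
  the pseudo-inverse solution.\<close>

definition AA_least_squares :: "(nat \<Rightarrow> real^'n) \<Rightarrow> nat \<Rightarrow> nat \<Rightarrow> (nat \<Rightarrow> real) \<Rightarrow> bool" where
  "AA_least_squares r k p =
     is_arg_min (\<lambda>\<beta>. (norm (r k + (\<Sum>i=1..p. \<beta> i *\<^sub>R (r k - r (k - i)))))\<^sup>2) (\<lambda>\<beta>. True)"

definition AA_coefficients :: "(nat \<Rightarrow> real^'n) \<Rightarrow> nat \<Rightarrow> nat \<Rightarrow> (nat \<Rightarrow> real) \<Rightarrow> bool" where
  "AA_coefficients r k p =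
     is_arg_min (\<lambda>\<beta>. L2_set \<beta> {1..p}) (AA_least_squares r k p)"

definition anderson_acceleration ::
  "real^'n^'n \<Rightarrow> real^'n \<Rightarrow> nat \<Rightarrow> real^'n \<Rightarrow> (nat \<Rightarrow> real^'n) \<Rightarrow> bool" where
  "anderson_acceleration M b m x0 x \<longleftrightarrow>
     x 0 = x0 \<and>
     (\<forall>k. \<exists>\<beta>. AA_coefficients (\<lambda>j. fp_residual M b (x j)) k (min k m) \<beta> \<and>
        x (Suc k) = fp_map M b (x k) +
          (\<Sum>i=1..min k m. \<beta> i *\<^sub>R (fp_map M b (x k) - fp_map M b (x (k - i)))))"

text \<open>The iterated map \<open>((*v) A ^^ j)\<close> is used because \<open>A ^ j\<close> on \<open>real^'n^'n\<close> is the
  componentwise power, not the matrix power.\<close>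

definition krylov :: "real^'n^'n \<Rightarrow> real^'n \<Rightarrow> nat \<Rightarrow> (real^'n) set" where
  "krylov A v k = span ((\<lambda>j. ((*v) A ^^ j) v) ` {..<k})"

definition gmres_iterate ::
  "real^'n^'n \<Rightarrow> real^'n \<Rightarrow> real^'n \<Rightarrow> nat \<Rightarrow> real^'n \<Rightarrow> bool" where
  "gmres_iterate A b x0 k =
     is_arg_min (\<lambda>y. norm (A *v y - b)) (\<lambda>y. y \<in> (+) x0 ` krylov A (A *v x0 - b) k)"

end

theory Submission imports Defs begin

text \<open>
  GMRES minimizes the residual norm over the affine Krylov space \<open>x0 + K\<^sub>k\<close>, so it suffices that
  the \<open>k\<close>-th Anderson iterate is one of the competitors.  This follows from
  \<open>q y = y - r y\<close> with \<open>r y = A (y - x0) + r0\<close>; hence one application of \<open>q\<close> carries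
  \<open>x0 + K\<^sub>k\<close> into \<open>x0 + K\<^bsub>k+1\<^esub>\<close> (lemma \<open>fp_map_mem_krylov\<close>), and \<open>x\<^bsub>k+1\<^esub>\<close> is an affine
  combination of values of \<open>q\<close> at earlier iterates (lemma \<open>anderson_acceleration_mem_krylov\<close>).
\<close>

lemma fp_residual_eq: "fp_residual M b y = (mat 1 - M) *v y - b"
  by (simp add: fp_residual_def fp_map_def matrix_vector_mult_diff_rdistrib)

lemma krylov_mono: "k \<le> l \<Longrightarrow> krylov A v k \<subseteq> krylov A v l"
  unfolding krylov_def by (intro span_mono image_mono) auto

lemma start_mem_krylov_Suc: "v \<in> krylov A v (Suc k)"
  unfolding krylov_def by (rule span_base) (force intro: image_eqI[of _ _ 0])

lemma matrix_mult_mem_krylov_Suc: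
  assumes "w \<in> krylov A v k"
  shows "A *v w \<in> krylov A v (Suc k)"
proof -
  have "A *v w \<in> span ((*v) A ` (\<lambda>j. ((*v) A ^^ j) v) ` {..<k})"
    using assms linear_span_image[OF matrix_vector_mul_linear, of A]
    unfolding krylov_def by blast
  moreover have "(*v) A ` (\<lambda>j. ((*v) A ^^ j) v) ` {..<k} \<subseteq> (\<lambda>j. ((*v) A ^^ j) v) ` {..<Suc k}"
    by (force intro: image_eqI[of _ _ "Suc j" for j])
  ultimately show ?thesis
    unfolding krylov_def using span_mono by blast
qed

text \<open>The displacement \<open>q y - x0\<close> equals \<open>w - A w - r0\<close> for \<open>w = y - x0\<close>, and each of the three
  terms lies in the next Krylov space.\<close>

lemma fp_map_mem_krylov:
  fixes M :: "real^'n^'n"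
  defines "A \<equiv> mat 1 - M"
  assumes "y - x0 \<in> krylov A (A *v x0 - b) k"
  shows "fp_map M b y - x0 \<in> krylov A (A *v x0 - b) (Suc k)"
proof -
  let ?K = "krylov A (A *v x0 - b)"
  have "fp_map M b y - x0 = (y - x0) - A *v (y - x0) - (A *v x0 - b)"
    by (simp add: A_def fp_map_def matrix_vector_mult_diff_rdistrib matrix_vector_mult_diff_distrib)
  moreover have "y - x0 \<in> ?K (Suc k)"
    using assms(2) krylov_mono[of k "Suc k"] by auto
  moreover have "A *v (y - x0) \<in> ?K (Suc k)"
    using assms(2) by (rule matrix_mult_mem_krylov_Suc)
  moreover have "A *v x0 - b \<in> ?K (Suc k)"
    by (rule start_mem_krylov_Suc)
  ultimately show ?thesis
    unfolding krylov_def by (metis span_diff)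
qed

text \<open>The recurrence reaches back to all earlier iterates, so the induction is a strong one; the
  nesting of the Krylov spaces puts every \<open>q x\<^sub>j - x0\<close> with \<open>j \<le> k\<close> into the same subspace.\<close>

lemma anderson_acceleration_mem_krylov:
  fixes M :: "real^'n^'n"
  defines "A \<equiv> mat 1 - M"
  assumes AA: "anderson_acceleration M b m x0 x"
  shows "x k - x0 \<in> krylov A (A *v x0 - b) k"
proof (induction k rule: less_induct)
  case (less k)
  let ?K = "krylov A (A *v x0 - b)"
  show ?case
  proof (cases k)
    case 0
    then show ?thesis
      using AA by (simp add: anderson_acceleration_def krylov_def)
  next
    case (Suc l)
    define d where "d j = fp_map M b (x j) - x0" for j
    have d: "d j \<in> ?K k" if "j \<le> l" for j
    proof -
      have "fp_map M b (x j) - x0 \<in> ?K (Suc j)"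
        using less.IH[of j] that Suc unfolding A_def by (intro fp_map_mem_krylov) auto
      then show ?thesis
        unfolding d_def using krylov_mono[of "Suc j" k] that Suc by auto
    qed
    obtain \<beta> where "x k = fp_map M b (x l) +
        (\<Sum>i=1..min l m. \<beta> i *\<^sub>R (fp_map M b (x l) - fp_map M b (x (l - i))))"
      using AA Suc unfolding anderson_acceleration_def by blast
    then have "x k - x0 = d l + (\<Sum>i=1..min l m. \<beta> i *\<^sub>R (d l - d (l - i)))"
      by (simp add: d_def)
    also have "\<dots> \<in> ?K k"
      using d unfolding krylov_def
      by (intro span_add span_sum span_scale span_diff) auto
    finally show ?thesis .
  qed
qed

theorem proposition2p4:
  fixes M A :: "real^'n^'n" and b x0 :: "real^'n"
    and x xG :: "nat \<Rightarrow> real^'n" and m :: nat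
  assumes "A = mat 1 - M" and "invertible A" and "M \<noteq> 0"
    and "m \<ge> 1"
    and "anderson_acceleration M b m x0 x"
    and "\<forall>k. gmres_iterate A b x0 k (xG k)"
  shows "\<forall>k. norm (fp_residual M b (x k)) \<ge> norm (A *v xG k - b)"
proof
  fix k
  have "x k - x0 \<in> krylov A (A *v x0 - b) k"
    using anderson_acceleration_mem_krylov assms(1,5) by blast
  then have "x k \<in> (+) x0 ` krylov A (A *v x0 - b) k"
    by (intro image_eqI[of _ _ "x k - x0"]) auto
  then have "norm (A *v xG k - b) \<le> norm (A *v x k - b)"
    using assms(6) by (auto simp: gmres_iterate_def is_arg_min_linorder)
  then show "norm (fp_residual M b (x k)) \<ge> norm (A *v xG k - b)"
    by (simp add: fp_residual_eq assms(1))
qed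

end
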